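(* Let $n=\nu_{i_1}+\nu_{i_2}+\cdots+\nu_{i_k}$, where $k\ge 1$ and $i_1,\dots,i_k$ are positive integers. If $i_j-i_{j-1}\ge 3$ for every $j$ with $2\le j\le k$, then $\delta(n)=\delta_P(n)=k$.
   Context: $\nu_\ell=2^\ell-1$. $\mathcal{T}_\infty$ is the infinite binary tree with all leaves at the same level: its vertices are the pairs $(i,j)$ of integers with $i\ge 1$, $j\ge 0$; the vertex $(i,j)$ has parent $(i+1,\lfloor j/2\rfloor)$, and the edges join each vertex to its parent. For a finite vertex set $S$, $\overline S$ is its complement and $(S,\overline S)$ is the set of edges with one end in $S$ and the other in $\overline S$. $\delta(n)$ is the minimum of $|(S,\overline S)|$ over all $S\subset V(\mathcal{T}_\infty)$ with $|S|=n$; $\delta_P(n)$ is the minimum over those $S$ with $|S|=n$ for which $\overline S$ induces a connected subgraph. *)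

theory Defs
  imports "Graph_Theory.Graph_Theory"
begin

definition nu :: "nat \<Rightarrow> nat" where
  "nu l = 2 ^ l - 1"

fun parent :: "nat \<times> nat \<Rightarrow> nat \<times> nat" where
  "parent (i, j) = (i + 1, j div 2)"

text \<open>The undirected tree is represented, as usual in \<^theory>\<open>Graph_Theory.Graph_Theory\<close>,
  by a symmetric digraph: each edge gives two opposite arcs.\<close>

definition T_inf :: "(nat \<times> nat) pair_pre_digraph" where
  "T_inf = \<lparr> pverts = {(i, j). 1 \<le> i},
             parcs = (\<Union>v \<in> {(i, j). 1 \<le> i}. {(v, parent v), (parent v, v)}) \<rparr>"

text \<open>The elements are undirected edges (two-element sets), so that no edge is counted twice.\<close>

definition cut :: "(nat \<times> nat) set \<Rightarrow> (nat \<times> nat) set set" where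
  "cut S = {{u, v} | u v. (u, v) \<in> parcs T_inf \<and> u \<in> S \<and> v \<in> pverts T_inf - S}"

definition vertex_sets :: "nat \<Rightarrow> (nat \<times> nat) set set" where
  "vertex_sets n = {S. S \<subseteq> pverts T_inf \<and> finite S \<and> card S = n}"

definition vertex_sets_P :: "nat \<Rightarrow> (nat \<times> nat) set set" where
  "vertex_sets_P n =
     {S \<in> vertex_sets n. connected (induce_subgraph (with_proj T_inf) (pverts T_inf - S))}"

text \<open>The infima are minima and the cardinalities are genuine: see \<open>finite_cut\<close>,
  \<open>delta_attained\<close> and \<open>delta_P_attained\<close> below.\<close>

definition delta :: "nat \<Rightarrow> nat" where
  "delta n = (INF S \<in> vertex_sets n. card (cut S))"

definition delta_P :: "nat \<Rightarrow> nat" where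
  "delta_P n = (INF S \<in> vertex_sets_P n. card (cut S))"

lemma pverts_T_inf: "v \<in> pverts T_inf \<longleftrightarrow> 1 \<le> fst v"
  by (auto simp: T_inf_def)

lemma parcs_T_inf:
  "(u, v) \<in> parcs T_inf \<longleftrightarrow> 1 \<le> fst u \<and> 1 \<le> fst v \<and> (v = parent u \<or> u = parent v)"
  by (cases u; cases v) (auto simp: T_inf_def)

lemma finite_cut:
  assumes "finite S"
  shows "finite (cut S)"
proof -
  have "cut S \<subseteq> (\<lambda>u. {u, parent u}) ` S
      \<union> (\<Union>(i, j) \<in> S. {{(i, j), (i - 1, 2 * j)}, {(i, j), (i - 1, 2 * j + 1)}})"
  proof
    fix e assume "e \<in> cut S"
    then obtain u v where e: "e = {u, v}" "(u, v) \<in> parcs T_inf" "u \<in> S"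
      by (auto simp: cut_def)
    consider "v = parent u" | "u = parent v"
      using e(2) parcs_T_inf by blast
    then show "e \<in> (\<lambda>u. {u, parent u}) ` S
      \<union> (\<Union>(i, j) \<in> S. {{(i, j), (i - 1, 2 * j)}, {(i, j), (i - 1, 2 * j + 1)}})"
    proof cases
      case 1
      then show ?thesis using e by auto
    next
      case 2
      obtain a b where v: "v = (a, b)" by (cases v)
      have "b = 2 * (b div 2) \<or> b = 2 * (b div 2) + 1" by linarith
      then have "e \<in> {{(a + 1, b div 2), (a + 1 - 1, 2 * (b div 2))},
          {(a + 1, b div 2), (a + 1 - 1, 2 * (b div 2) + 1)}}"
        using 2 v e by auto
      moreover have "(a + 1, b div 2) \<in> S" using 2 v e by simp
      ultimately show ?thesis by blast
    qed
  qed
  then show ?thesis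
    by (rule finite_subset) (use assms in auto)
qed

lemma parent_closed_connected:
  assumes sub: "C \<subseteq> pverts T_inf" and ne: "C \<noteq> {}" and up: "\<And>v. v \<in> C \<Longrightarrow> parent v \<in> C"
  shows "connected (induce_subgraph (with_proj T_inf) C)"
proof -
  let ?G = "with_proj (mk_symmetric (induce_subgraph (with_proj T_inf) C))"
  define R where "R = rtrancl_on C (arcs_ends ?G)"
  have V: "verts ?G = C"
    by (simp add: mk_symmetric_def with_proj_def)
  have A: "(v, parent v) \<in> arcs_ends ?G \<and> (parent v, v) \<in> arcs_ends ?G" if "v \<in> C" for v
  proof -
    have "(v, parent v) \<in> parcs T_inf"
      using that sub up[OF that] by (auto simp: parcs_T_inf pverts_T_inf)
    then show ?thesis using that up[OF that]
      by (auto simp: mk_symmetric_def arcs_ends_conv with_proj_def induce_subgraph_def image_iff)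
        (metis prod.collapse)+
  qed
  have refl: "(v, v) \<in> R" if "v \<in> C" for v
    using that by (simp add: R_def)
  have trans: "(x, z) \<in> R" if "(x, y) \<in> R" "(y, z) \<in> R" for x y z
    using that unfolding R_def by (rule rtrancl_on_trans)
  have step: "(v, parent v) \<in> R \<and> (parent v, v) \<in> R" if "v \<in> C" for v
    using A[OF that] that up[OF that] unfolding R_def
    by (meson rtrancl_on.intros)
  have up': "(parent ^^ k) v \<in> C \<and> (v, (parent ^^ k) v) \<in> R \<and> ((parent ^^ k) v, v) \<in> R"
    if "v \<in> C" for v k
  proof (induction k)
    case 0
    then show ?case using that refl by simp
  next
    case (Suc k)
    then show ?case using step[of "(parent ^^ k) v"] up trans by simp blast
  qed
  have it: "(parent ^^ k) (i, j) = (i + k, j div 2 ^ k)" for i j k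
    by (induction k) (auto simp flip: div_mult2_eq simp: mult.commute)
  have small: "j div 2 ^ k = 0" if "j \<le> k" for j k :: nat
    using that by (metis div_less less_exp order_le_less_trans)
  have "(u, v) \<in> R" if "u \<in> C" "v \<in> C" for u v
  proof -
    obtain a b c d where uv: "u = (a, b)" "v = (c, d)" by (cases u; cases v)
    have "(parent ^^ (b + d + c)) u = (a + b + d + c, 0)"
      by (simp add: uv it small)
    moreover have "(parent ^^ (b + d + a)) v = (a + b + d + c, 0)"
      by (simp add: uv it small)
    ultimately have "(parent ^^ (b + d + c)) u = (parent ^^ (b + d + a)) v" by simp
    then show ?thesis using up'[OF that(1)] up'[OF that(2)] trans by metis
  qed
  then show ?thesis
    unfolding connected_def strongly_connected_def reachable_def V R_def using ne by blast
qed

lemma vertex_sets_P_nonempty: "vertex_sets_P n \<noteq> {}"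
proof -
  define S where "S = Pair (1::nat) ` {..<n}"
  have "card S = n" by (simp add: S_def card_image inj_on_def)
  then have "S \<in> vertex_sets n"
    by (auto simp: vertex_sets_def S_def pverts_T_inf)
  moreover have "connected (induce_subgraph (with_proj T_inf) (pverts T_inf - S))"
  proof (rule parent_closed_connected)
    have "(2, 0) \<in> pverts T_inf - S" by (auto simp: S_def pverts_T_inf)
    then show "pverts T_inf - S \<noteq> {}" by blast
  qed (auto simp: S_def pverts_T_inf)
  ultimately show ?thesis by (auto simp: vertex_sets_P_def)
qed

lemma delta_attained: "\<exists>S \<in> vertex_sets n. card (cut S) = delta n"
  and delta_P_attained: "\<exists>S \<in> vertex_sets_P n. card (cut S) = delta_P n"
proof -
  have "vertex_sets n \<noteq> {}"
    using vertex_sets_P_nonempty[of n] by (auto simp: vertex_sets_P_def)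
  then show "\<exists>S \<in> vertex_sets n. card (cut S) = delta n"
    using Inf_nat_def1[of "(\<lambda>S. card (cut S)) ` vertex_sets n"] by (auto simp: delta_def)
  show "\<exists>S \<in> vertex_sets_P n. card (cut S) = delta_P n"
    using vertex_sets_P_nonempty[of n]
      Inf_nat_def1[of "(\<lambda>S. card (cut S)) ` vertex_sets_P n"] by (auto simp: delta_P_def)
qed

end

theory Submission
  imports Defs
begin

text \<open>
  If \<open>C\<close> is the set of children of vertices of \<open>S\<close>, then
  \<open>\<nu>\<^sub>\<ell> = 2\<nu>\<^sub>\<ell>\<^sub>-\<^sub>1 + 1\<close> gives \<open>|S| = \<Sum>\<^sub>P \<nu> - \<Sum>\<^sub>Q \<nu>\<close> with \<open>P = S - C\<close> and \<open>Q = C - S\<close>, and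
  \<open>P \<union> Q\<close> is in bijection with the cut. So \<open>N = \<Sum>\<^sub>j 2 ^ i\<^sub>j\<close> is a sum of \<open>p = |P|\<close> positive and
  \<open>q = |Q|\<close> negative powers of two plus the even number \<open>d = k - p + q\<close>.
  Charge 2 for a positive and 1 for a negative power of two. Because the gaps are at least 3,
  any signed representation of \<open>N\<close> costs at least \<open>2k\<close>, whereas \<open>d\<close> costs at most \<open>d/2 + 1\<close>;
  hence \<open>2p + q + (k - p + q)/2 + 1 \<ge> 2k\<close>, which forces \<open>p + q \<ge> k\<close>.
  Equality is attained by complete subtrees rooted at the vertices \<open>(i\<^sub>j, 1)\<close>, none of which
  is an ancestor of another.
\<close>

section \<open>The cost of signed binary representations\<close>

text \<open>The least value of \<open>2p + q\<close> over all ways to write the argument as a sum of \<open>p\<close> powers of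
  two minus a sum of \<open>q\<close> powers of two.\<close>

function signed_cost :: "int \<Rightarrow> nat" where
  "signed_cost x =
    (if x = 0 then 0 else if x = 1 then 2 else if x = -1 then 1
     else if even x then signed_cost (x div 2)
     else min (2 + signed_cost (x div 2)) (1 + signed_cost (x div 2 + 1)))"
  by auto
termination
  by (relation "measure (\<lambda>x. nat \<bar>x\<bar>)") (auto, presburger+)

declare signed_cost.simps [simp del]

lemma signed_cost_0 [simp]: "signed_cost 0 = 0"
  and signed_cost_1 [simp]: "signed_cost 1 = 2"
  and signed_cost_minus_1 [simp]: "signed_cost (-1) = 1"
  by (simp_all add: signed_cost.simps)

lemma signed_cost_double [simp]: "signed_cost (2 * x) = signed_cost x"
proof -
  have "2 * x \<noteq> 1" "2 * x \<noteq> -1" by presburger+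
  then show ?thesis by (cases "x = 0") (simp_all add: signed_cost.simps[of "2 * x"])
qed

text \<open>The values at 1 and -1 are separate in the definition only because the recursion would
  call itself there; they satisfy the recursion as well.\<close>

lemma signed_cost_odd:
  "signed_cost (2 * x + 1) = min (2 + signed_cost x) (1 + signed_cost (x + 1))"
proof -
  consider "x = 0" | "x = -1" | "2 * x + 1 \<noteq> 0" "2 * x + 1 \<noteq> 1" "2 * x + 1 \<noteq> -1"
    by linarith
  then show ?thesis
    by cases (simp_all add: signed_cost.simps[of "2 * x + 1"])
qed

text \<open>For even \<open>x\<close> one unfolding suffices. For odd \<open>x = 2 * y + 1\<close>
  both neighbours are even, so only the costs of \<open>y\<close> and \<open>y + 1\<close> have to
  be compared.\<close>

lemma signed_cost_succ_pred:
  "signed_cost (x + 1) \<le> signed_cost x + 2 \<and> signed_cost (x - 1) \<le> signed_cost x + 1"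
proof (induction "nat \<bar>x\<bar>" arbitrary: x rule: less_induct)
  case less
  show ?case
  proof (cases "even x")
    case True
    then obtain y where y: "x = 2 * y" by auto
    have "signed_cost (x + 1) \<le> signed_cost x + 2"
      using signed_cost_odd[of y] by (simp add: y)
    moreover have "signed_cost (x - 1) \<le> signed_cost x + 1"
    proof -
      have "x - 1 = 2 * (y - 1) + 1" using y by simp
      then show ?thesis by (simp only: signed_cost_odd y signed_cost_double) simp
    qed
    ultimately show ?thesis by simp
  next
    case False
    then obtain y where y: "x = 2 * y + 1" by (elim oddE)
    have up: "signed_cost (x + 1) = signed_cost (y + 1)"
      using signed_cost_double[of "y + 1"] by (simp add: y algebra_simps)
    have down: "signed_cost (x - 1) = signed_cost y" by (simp add: y)
    have at: "signed_cost x = min (2 + signed_cost y) (1 + signed_cost (y + 1))"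
      by (simp add: y signed_cost_odd)
    \<comment> \<open>For \<open>x\<close> equal to 1 or -1, one of \<open>y\<close>,
      \<open>y + 1\<close> is \<open>x\<close> itself, beyond the reach of the induction hypothesis;
      these cases are evaluated directly.\<close>
    have "signed_cost (y + 1) \<le> signed_cost y + 2"
    proof (cases "y = 0 \<or> y = -1")
      case False
      then show ?thesis using less[of y] y by auto
    qed auto
    moreover have "signed_cost y \<le> signed_cost (y + 1) + 1"
    proof (cases "y = 0 \<or> y = -1")
      case False
      then show ?thesis using less[of "y + 1"] y by auto
    qed auto
    ultimately show ?thesis by (simp only: up down at) linarith
  qed
qed

lemma signed_cost_add_power:
  "signed_cost (x + 2 ^ l) \<le> signed_cost x + 2 \<and> signed_cost (x - 2 ^ l) \<le> signed_cost x + 1"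
proof (induction l arbitrary: x)
  case 0
  then show ?case using signed_cost_succ_pred[of x] by simp
next
  case (Suc l)
  show ?case
  proof (cases "even x")
    case True
    then obtain y where y: "x = 2 * y" by auto
    have "x + 2 ^ Suc l = 2 * (y + 2 ^ l)" "x - 2 ^ Suc l = 2 * (y - 2 ^ l)"
      by (simp_all add: y)
    then show ?thesis using Suc[of y] y by (simp only: signed_cost_double)
  next
    case False
    then obtain y where y: "x = 2 * y + 1" by (elim oddE)
    have "x + 2 ^ Suc l = 2 * (y + 2 ^ l) + 1" "x - 2 ^ Suc l = 2 * (y - 2 ^ l) + 1"
      by (simp_all add: y)
    moreover have "y + 2 ^ l + 1 = y + 1 + 2 ^ l" "y - 2 ^ l + 1 = y + 1 - 2 ^ l"
      by simp_all
    ultimately show ?thesis using Suc[of y] Suc[of "y + 1"] y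
      by (simp only: signed_cost_odd) linarith
  qed
qed

lemma signed_cost_sum_add:
  assumes "finite P"
  shows "signed_cost (x + (\<Sum>v\<in>P. 2 ^ l v)) \<le> signed_cost x + 2 * card P"
  using assms
proof (induction P rule: finite_induct)
  case (insert v P)
  then show ?case
    using signed_cost_add_power[of "x + (\<Sum>v\<in>P. 2 ^ l v)" "l v"] by (simp add: ac_simps)
qed simp

lemma signed_cost_sum_diff:
  assumes "finite Q"
  shows "signed_cost (x - (\<Sum>v\<in>Q. 2 ^ l v)) \<le> signed_cost x + card Q"
  using assms
proof (induction Q rule: finite_induct)
  case (insert v Q)
  then show ?case
    using signed_cost_add_power[of "x - (\<Sum>v\<in>Q. 2 ^ l v)" "l v"]
    by (simp add: diff_diff_eq ac_simps)
qed simp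

text \<open>The even number is split into 4s, each of cost 2, and at most one 2, also of cost 2; the
  latter accounts for the extra 1.\<close>

lemma signed_cost_add_even: "signed_cost (x + 2 * int e) \<le> signed_cost x + e + 1"
proof (induction e rule: induct_nat_012)
  case 1
  then show ?case using signed_cost_add_power[of x 1] by simp
next
  case (ge2 e)
  then show ?case using signed_cost_add_power[of "x + 2 * int e" 2] by (simp add: algebra_simps)
qed simp

text \<open>The second bound covers a carry into the number from below.\<close>

lemma signed_cost_sparse_sum:
  assumes "\<And>j. j < k \<Longrightarrow> b \<le> i j"
    and "\<And>j j'. j < j' \<Longrightarrow> j' < k \<Longrightarrow> i j + 3 \<le> i j'"
  shows "2 * k \<le> signed_cost (\<Sum>j<k. 2 ^ (i j - b)) \<and>
         2 * k \<le> signed_cost ((\<Sum>j<k. 2 ^ (i j - b)) + 1) + 1"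
  using assms
proof (induction k arbitrary: i b)
  case 0
  then show ?case by simp
next
  case (Suc k)
  \<comment> \<open>The tail, rescaled using the first gap, so that the whole sum is
    \<open>8 * x + 1\<close> times a power of two.\<close>
  define x :: int where "x = (\<Sum>j<k. 2 ^ (i (Suc j) - (i 0 + 3)))"
  have IH: "2 * k \<le> signed_cost x" "2 * k \<le> signed_cost (x + 1) + 1"
    using Suc.IH[of "i 0 + 3" "\<lambda>j. i (Suc j)"] Suc.prems(2) unfolding x_def by auto
  \<comment> \<open>The three doublings allowed by the gap raise the bound from \<open>2 * k\<close>
    through \<open>2 * k + 1\<close> to \<open>2 * k + 2\<close>: a carry upwards costs 1 and must
    pass every zero in between.\<close>
  have odd2: "2 * k \<le> signed_cost (2 * x + 1)"
    using IH by (simp add: signed_cost_odd)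
  have odd4: "2 * k + 1 \<le> signed_cost (4 * x + 1)"
  proof -
    have "4 * x + 1 = 2 * (2 * x) + 1" by simp
    then show ?thesis using IH odd2 by (simp only: signed_cost_odd signed_cost_double)
  qed
  have odd8: "2 * Suc k \<le> signed_cost (8 * x + 1)"
  proof -
    have "signed_cost (4 * x) = signed_cost x"
      using signed_cost_double[of x] signed_cost_double[of "2 * x"] by simp
    moreover have "8 * x + 1 = 2 * (4 * x) + 1" by simp
    then have "signed_cost (8 * x + 1)
        = min (2 + signed_cost (4 * x)) (1 + signed_cost (4 * x + 1))"
      by (metis signed_cost_odd)
    ultimately show ?thesis using IH odd4 by simp
  qed
  have carry8: "2 * Suc k \<le> signed_cost (8 * x + 1 + 1) + 1"
  proof -
    have "8 * x + 1 + 1 = 2 * (4 * x + 1)" by simp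
    then have "signed_cost (8 * x + 1 + 1) = signed_cost (4 * x + 1)"
      by (metis signed_cost_double)
    then show ?thesis using odd4 by simp
  qed
  have shift: "2 * Suc k \<le> signed_cost (2 ^ t * (8 * x + 1)) \<and>
      2 * Suc k \<le> signed_cost (2 ^ t * (8 * x + 1) + 1) + 1" for t
  proof (induction t)
    case 0
    then show ?case using odd8 carry8 by (simp only: power_0 mult_1_left)
  next
    case (Suc t)
    define y where "y = 2 ^ t * (8 * x + 1)"
    have "2 ^ Suc t * (8 * x + 1) = 2 * y" by (simp add: y_def)
    then show ?case using Suc[folded y_def]
      by (simp only: signed_cost_odd signed_cost_double) simp
  qed
  have "(\<Sum>j<Suc k. 2 ^ (i j - b)) = 2 ^ (i 0 - b) * (8 * x + 1)"
  proof -
    have "(2::int) ^ (i (Suc j) - b) = 2 ^ (i 0 - b) * (8 * 2 ^ (i (Suc j) - (i 0 + 3)))"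
      if "j < k" for j
    proof -
      have eq: "i (Suc j) - b = (i 0 - b) + (3 + (i (Suc j) - (i 0 + 3)))"
        using Suc.prems(1)[of 0] Suc.prems(2)[of 0 "Suc j"] that by simp
      show ?thesis by (subst eq) (simp add: power_add)
    qed
    then have "(\<Sum>j<k. (2::int) ^ (i (Suc j) - b)) = 2 ^ (i 0 - b) * (8 * x)"
      unfolding x_def sum_distrib_left by (intro sum.cong) auto
    then show ?thesis
      unfolding sum.lessThan_Suc_shift distrib_left by linarith
  qed
  then show ?case using shift by simp
qed

section \<open>Arithmetic of \<open>nu\<close> and the number of terms in a signed sum\<close>

lemma int_nu: "int (nu l) = 2 ^ l - 1"
  by (simp add: nu_def of_nat_diff)

lemma nu_0: "nu 0 = 0"
  by (simp add: nu_def)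

lemma nu_Suc: "nu (Suc l) = 2 * nu l + 1"
proof -
  have "int (nu (Suc l)) = int (2 * nu l + 1)"
    by (simp only: of_nat_add of_nat_mult int_nu) simp
  then show ?thesis by (simp only: of_nat_eq_iff)
qed

lemma sparse_nu_sum_terms:
  fixes i :: "nat \<Rightarrow> nat" and l :: "'a \<Rightarrow> nat"
  assumes pos: "\<And>j. j < k \<Longrightarrow> 1 \<le> i j"
    and gap: "\<And>j j'. j < j' \<Longrightarrow> j' < k \<Longrightarrow> i j + 3 \<le> i j'"
    and fin: "finite P" "finite Q"
    and l: "\<And>v. v \<in> P \<union> Q \<Longrightarrow> 1 \<le> l v"
    and eq: "(\<Sum>j<k. nu (i j)) + (\<Sum>v\<in>Q. nu (l v)) = (\<Sum>v\<in>P. nu (l v))"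
  shows "k \<le> card P + card Q"
proof (rule ccontr)
  assume less: "\<not> ?thesis"
  define N X :: int where "N = (\<Sum>j<k. 2 ^ i j)"
    and "X = (\<Sum>v\<in>P. 2 ^ l v) - (\<Sum>v\<in>Q. 2 ^ l v)"
  have "int (\<Sum>j<k. nu (i j)) + int (\<Sum>v\<in>Q. nu (l v)) = int (\<Sum>v\<in>P. nu (l v))"
    using eq by linarith
  then have d: "N = X + (int k - int (card P) + int (card Q))"
    by (simp add: int_nu sum_subtractf N_def X_def)
  have "even N"
    unfolding N_def using pos by (intro dvd_sum) (simp add: Suc_le_eq)
  moreover have "even X"
    unfolding X_def using l by (intro dvd_diff dvd_sum) (auto simp: Suc_le_eq)
  ultimately have "even (int k - int (card P) + int (card Q))"
    using d by (metis even_add)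
  then obtain e' where e': "int k - int (card P) + int (card Q) = 2 * e'" by (elim evenE)
  \<comment> \<open>Nothing is truncated: the assumption gives \<open>card P < k\<close>, so
    \<open>e'\<close> is positive.\<close>
  define e where "e = nat e'"
  have e: "int k - int (card P) + int (card Q) = 2 * int e"
    using e' less by (simp add: e_def)
  have "2 * k \<le> signed_cost N"
    using signed_cost_sparse_sum[of k 0 i] gap by (simp add: N_def)
  also have "\<dots> \<le> signed_cost X + e + 1"
    using signed_cost_add_even[of X e] d e by simp
  also have "signed_cost X \<le> 2 * card P + card Q"
    using signed_cost_sum_diff[OF fin(2), of "\<Sum>v\<in>P. 2 ^ l v" l]
      signed_cost_sum_add[OF fin(1), of 0 l] by (simp add: X_def)
  \<comment> \<open>Doubling and substituting for \<open>2 * e\<close> gives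
    \<open>3 * k \<le> 3 * (card P + card Q) + 2\<close>, hence
    \<open>k \<le> card P + card Q\<close> by integrality.\<close>
  finally show False using e less by linarith
qed

section \<open>Cuts of the tree\<close>

definition children :: "(nat \<times> nat) set \<Rightarrow> (nat \<times> nat) set" where
  "children S = {v. 1 \<le> fst v \<and> parent v \<in> S}"

lemma fst_parent [simp]: "fst (parent v) = fst v + 1"
  by (cases v) simp

lemma children_singleton:
  "children {(a, b)} = (if a \<le> 1 then {} else {(a - 1, 2 * b), (a - 1, 2 * b + 1)})"
  by (auto simp: children_def)

lemma children_eq_UN: "children S = (\<Union>w\<in>S. children {w})"
  by (auto simp: children_def)

lemma finite_children: "finite S \<Longrightarrow> finite (children S)"
  by (subst children_eq_UN) (auto simp: children_singleton)

text \<open>Each vertex of \<open>S\<close> contributes 1, the excess of its \<open>nu\<close> over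
  that of its children. Distinct vertices have disjoint sets of children, and the terms of
  \<open>S \<inter> children S\<close> cancel.\<close>

lemma card_eq_nu_sums:
  assumes "S \<subseteq> pverts T_inf" "finite S"
  shows "card S + (\<Sum>v\<in>children S - S. nu (fst v)) = (\<Sum>v\<in>S - children S. nu (fst v))"
proof -
  let ?C = "children S"
  have fin: "finite ?C" using assms(2) by (rule finite_children)
  have one: "(\<Sum>v\<in>children {w}. nu (fst v)) + 1 = nu (fst w)" if "w \<in> S" for w
  proof -
    obtain a b where w: "w = (a, b)" by (cases w)
    have "1 \<le> a" using that assms(1) by (auto simp: w pverts_T_inf)
    then obtain c where c: "a = Suc c" by (cases a) auto
    have "children {w} = (if c = 0 then {} else {(c, 2 * b), (c, 2 * b + 1)})"
      by (simp add: w c children_singleton)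
    \<comment> \<open>Leaves, where \<open>c = 0\<close>, fit the formula because
      \<open>nu 0 = 0\<close>.\<close>
    then have "(\<Sum>v\<in>children {w}. nu (fst v)) = 2 * nu c"
      by (simp add: nu_0)
    then show ?thesis by (simp add: w c nu_Suc)
  qed
  have C: "(\<Sum>v\<in>?C. nu (fst v)) = (\<Sum>w\<in>S. \<Sum>v\<in>children {w}. nu (fst v))"
  proof -
    have "(\<Sum>v\<in>(\<Union>w\<in>S. children {w}). nu (fst v))
        = (\<Sum>w\<in>S. \<Sum>v\<in>children {w}. nu (fst v))"
    proof (rule sum.UNION_disjoint)
      show "\<forall>w\<in>S. finite (children {w})" by (simp add: finite_children)
      show "\<forall>w\<in>S. \<forall>w'\<in>S. w \<noteq> w' \<longrightarrow> children {w} \<inter> children {w'} = {}"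
        unfolding children_def by blast
    qed (rule assms(2))
    then show ?thesis by (simp only: flip: children_eq_UN)
  qed
  have "(\<Sum>v\<in>?C. nu (fst v)) + card S = (\<Sum>v\<in>S. nu (fst v))"
  proof -
    have "(\<Sum>v\<in>S. nu (fst v)) = (\<Sum>w\<in>S. (\<Sum>v\<in>children {w}. nu (fst v)) + 1)"
      using one by (intro sum.cong) simp_all
    also have "\<dots> = (\<Sum>w\<in>S. \<Sum>v\<in>children {w}. nu (fst v)) + card S"
      by (subst sum.distrib) simp
    finally show ?thesis using C by simp
  qed
  moreover have "(\<Sum>v\<in>S. nu (fst v))
      = (\<Sum>v\<in>S - ?C. nu (fst v)) + (\<Sum>v\<in>S \<inter> ?C. nu (fst v))"
    using assms(2) by (metis sum.Int_Diff add.commute)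
  moreover have "(\<Sum>v\<in>?C. nu (fst v))
      = (\<Sum>v\<in>?C - S. nu (fst v)) + (\<Sum>v\<in>S \<inter> ?C. nu (fst v))"
    using fin by (metis sum.Int_Diff add.commute Int_commute)
  ultimately show ?thesis by linarith
qed

text \<open>Every edge is named by its lower end \<open>v\<close>: the edge leaves \<open>S\<close>
  upwards if \<open>v\<close> is in \<open>S\<close>, and downwards otherwise.\<close>

lemma cut_eq_image:
  assumes "S \<subseteq> pverts T_inf"
  shows "cut S = (\<lambda>v. {v, parent v}) ` ((S - children S) \<union> (children S - S))"
proof (intro set_eqI iffI)
  fix e assume "e \<in> cut S"
  then obtain u v where "e = {u, v}" "(u, v) \<in> parcs T_inf" "u \<in> S" "v \<notin> S"
    by (auto simp: cut_def)
  then show "e \<in> (\<lambda>v. {v, parent v}) ` ((S - children S) \<union> (children S - S))"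
    by (auto simp: parcs_T_inf children_def)
next
  fix e assume "e \<in> (\<lambda>v. {v, parent v}) ` ((S - children S) \<union> (children S - S))"
  then obtain v where v: "e = {v, parent v}" "v \<in> (S - children S) \<union> (children S - S)"
    by auto
  have lev: "1 \<le> fst v" using v(2) assms by (auto simp: children_def pverts_T_inf)
  show "e \<in> cut S"
  proof (cases "v \<in> S")
    case True
    then have "(v, parent v) \<in> parcs T_inf" "parent v \<in> pverts T_inf - S"
      using v lev by (auto simp: parcs_T_inf pverts_T_inf children_def)
    then show ?thesis using v(1) True unfolding cut_def by blast
  next
    case False
    then have "e = {parent v, v}" "(parent v, v) \<in> parcs T_inf" "parent v \<in> S"
        "v \<in> pverts T_inf - S"
      using v lev by (auto simp: parcs_T_inf pverts_T_inf children_def)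
    then show ?thesis unfolding cut_def by blast
  qed
qed

lemma card_cut:
  assumes "S \<subseteq> pverts T_inf" "finite S"
  shows "card (cut S) = card (S - children S) + card (children S - S)"
proof -
  have "inj (\<lambda>v. {v, parent v})"
  proof (rule injI)
    fix v w assume eq: "{v, parent v} = {w, parent w}"
    show "v = w"
    proof (rule ccontr)
      assume "v \<noteq> w"
      with eq have "v = parent w" "w = parent v" by (auto simp: doubleton_eq_iff)
      then have "fst v = fst w + 1" "fst w = fst v + 1" by (metis fst_parent)+
      then show False by simp
    qed
  qed
  then have "card (cut S) = card ((S - children S) \<union> (children S - S))"
    unfolding cut_eq_image[OF assms(1)] by (intro card_image) (rule inj_on_subset, auto)
  then show ?thesis
    using assms(2) finite_children by (simp add: card_Un_disjoint disjoint_iff)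
qed

section \<open>Complete subtrees for the extremal set\<close>

text \<open>The descendants of \<open>(l, 1)\<close>, itself included: the quotient is the second
  coordinate of the ancestor at level \<open>l\<close>. Roots \<open>(l, 0)\<close> would give
  nested subtrees instead.\<close>

definition subtree :: "nat \<Rightarrow> (nat \<times> nat) set" where
  "subtree l = {(a, b). 1 \<le> a \<and> a \<le> l \<and> b div 2 ^ (l - a) = 1}"

lemma finite_subtree: "finite (subtree l)"
proof (rule finite_subset)
  show "subtree l \<subseteq> {..l} \<times> {..<2 * 2 ^ l}"
  proof
    fix v assume "v \<in> subtree l"
    then obtain a b where v: "v = (a, b)" "a \<le> l" "b div 2 ^ (l - a) = 1"
      by (auto simp: subtree_def)
    have "b < 2 * 2 ^ (l - a)"
      using v(3) by (simp flip: div_less_iff_less_mult)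
    also have "\<dots> \<le> 2 * 2 ^ l" by (simp add: power_increasing)
    finally show "v \<in> {..l} \<times> {..<2 * 2 ^ l}" using v by simp
  qed
qed simp

text \<open>Yields both that a subtree is closed under children and that its root is the only vertex
  whose parent lies outside.\<close>

lemma parent_in_subtree:
  assumes "1 \<le> fst v"
  shows "parent v \<in> subtree l \<longleftrightarrow> v \<in> subtree l \<and> v \<noteq> (l, 1)"
proof -
  obtain a b where v: "v = (a, b)" by (cases v)
  show ?thesis
  proof (cases "a < l")
    case True
    then have "l - a = Suc (l - Suc a)" by simp
    then have "b div 2 ^ (l - a) = b div 2 div 2 ^ (l - Suc a)"
      by (simp add: div_mult2_eq)
    then show ?thesis using True assms by (auto simp: v subtree_def)
  qed (auto simp: v subtree_def)
qed

theorem theorem3p22: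
  fixes n k :: nat and i :: "nat \<Rightarrow> nat"
  assumes "k \<ge> 1"
    and "\<forall>j\<in>{1..k}. i j \<ge> 1"
    and "n = (\<Sum>j=1..k. nu (i j))"
    and "\<forall>j\<in>{2..k}. int (i j) - int (i (j - 1)) \<ge> 3"
  shows "delta n = k \<and> delta_P n = k"
proof -
  define f where "f = (\<lambda>j. i (Suc j))"
  have n: "n = (\<Sum>j<k. nu (f j))"
    unfolding assms(3) f_def
    by (rule sum.reindex_bij_witness[of _ Suc "\<lambda>j. j - 1"]) auto
  have pos: "1 \<le> f j" if "j < k" for j
    using assms(2) that by (simp add: f_def)
  have gap: "f j + 3 \<le> f j'" if "j < j'" "j' < k" for j j'
    using that
  proof (induction j')
    case (Suc j')
    have "Suc (Suc j') \<in> {2..k}" using Suc.prems by simp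
    from bspec[OF assms(4) this] have "f j' + 3 \<le> f (Suc j')"
      by (simp add: f_def)
    then show ?case using Suc by (cases "j = j'") auto
  qed simp
  have inj: "inj_on f {..<k}"
  proof (rule linorder_inj_onI)
    fix j j' assume "j < j'" "j \<in> {..<k}" "j' \<in> {..<k}"
    then show "f j \<noteq> f j'" using gap[of j j'] by auto
  qed auto
  \<comment> \<open>This serves \<open>delta_P\<close> as well, whose sets form a subfamily.\<close>
  have lower: "k \<le> card (cut S)" if "S \<in> vertex_sets n" for S
  proof -
    have S: "S \<subseteq> pverts T_inf" "finite S" "card S = n"
      using that by (auto simp: vertex_sets_def)
    show ?thesis unfolding card_cut[OF S(1,2)]
    proof (rule sparse_nu_sum_terms[of k f _ _ fst])
      show "(\<Sum>j<k. nu (f j)) + (\<Sum>v\<in>children S - S. nu (fst v))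
          = (\<Sum>v\<in>S - children S. nu (fst v))"
        using card_eq_nu_sums[OF S(1,2)] S(3) n by simp
    qed (use pos gap S finite_children in \<open>auto simp: children_def pverts_T_inf\<close>)
  qed
  define S where "S = (\<Union>j<k. subtree (f j))"
  define R where "R = (\<lambda>j. (f j, 1::nat)) ` {..<k}"
  have "subtree l \<subseteq> pverts T_inf" for l
    by (auto simp: subtree_def pverts_T_inf)
  then have S: "S \<subseteq> pverts T_inf" "finite S"
    by (auto simp: S_def finite_subtree)
  have childS: "children S \<subseteq> S"
    unfolding children_def S_def using parent_in_subtree by blast
  \<comment> \<open>A common vertex would have \<open>(l, 1)\<close> as an ancestor, whose own
    ancestor at level \<open>l'\<close> has second coordinate 0, not 1.\<close>
  have "subtree l \<inter> subtree l' = {}" if "l < l'" for l l'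
  proof -
    have False if "1 \<le> a" "a \<le> l" "b div 2 ^ (l - a) = 1" "b div 2 ^ (l' - a) = 1" for a b :: nat
    proof -
      have "l' - a = (l - a) + (l' - l)" using that \<open>l < l'\<close> by simp
      then have "b div 2 ^ (l' - a) = 1 div 2 ^ (l' - l)"
        using that(3) by (simp only: power_add div_mult2_eq)
      also have "\<dots> = 0"
        using \<open>l < l'\<close> by (intro div_less one_less_power) simp_all
      finally show False using that by simp
    qed
    then show ?thesis by (auto simp: subtree_def)
  qed
  then have disj: "l = l'" if "v \<in> subtree l" "v \<in> subtree l'" for v l l'
    using that by (metis disjoint_iff linorder_neqE_nat)
  have root: "(l, 1) \<in> subtree l" if "1 \<le> l" for l
    using that by (simp add: subtree_def)
  have SR: "S - children S = R"
  proof
    show "S - children S \<subseteq> R"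
    proof
      fix v assume v: "v \<in> S - children S"
      then obtain j where "j < k" "v \<in> subtree (f j)" by (auto simp: S_def)
      then show "v \<in> R"
        using v parent_in_subtree[of v "f j"] S(1)
        by (auto simp: children_def S_def R_def pverts_T_inf)
    qed
    show "R \<subseteq> S - children S"
    proof
      fix v assume "v \<in> R"
      then obtain j where j: "j < k" "v = (f j, 1)" by (auto simp: R_def)
      have mem: "v \<in> subtree (f j)" using root pos j by simp
      have "v \<notin> children S"
      proof
        assume "v \<in> children S"
        then obtain j' where "j' < k" "v \<in> subtree (f j')" "v \<noteq> (f j', 1)"
          by (auto simp: children_def S_def parent_in_subtree)
        then show False using disj[OF mem] j by auto
      qed
      then show "v \<in> S - children S" using mem j by (auto simp: S_def)
    qed
  qed
  have R: "inj_on (\<lambda>j. (f j, 1::nat)) {..<k}"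
    using inj by (auto simp: inj_on_def)
  have "(\<Sum>v\<in>R. nu (fst v)) = n"
    unfolding R_def n by (subst sum.reindex[OF R]) simp
  \<comment> \<open>As \<open>children S - S\<close> is empty, only the sum over the roots
    remains.\<close>
  then have "card S = n"
    using card_eq_nu_sums[OF S] childS
    by (simp add: SR Diff_eq_empty_iff[THEN iffD2])
  then have Sn: "S \<in> vertex_sets n" using S by (simp add: vertex_sets_def)
  \<comment> \<open>Since \<open>S\<close> is closed under children, its complement is closed under
    parents; it is nonempty because \<open>S\<close> is finite.\<close>
  moreover have "connected (induce_subgraph (with_proj T_inf) (pverts T_inf - S))"
  proof (rule parent_closed_connected)
    have "infinite (pverts T_inf)"
    proof
      assume "finite (pverts T_inf)"
      moreover have "Pair 1 ` UNIV \<subseteq> pverts T_inf" by (auto simp: pverts_T_inf)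
      ultimately have "finite (Pair (1::nat) ` (UNIV :: nat set))" by (rule rev_finite_subset)
      then show False by (auto dest!: finite_imageD simp: inj_on_def)
    qed
    then show "pverts T_inf - S \<noteq> {}" using S(2) by (metis finite.emptyI finite_Diff2)
  qed (use childS in \<open>auto simp: children_def pverts_T_inf\<close>)
  ultimately have SP: "S \<in> vertex_sets_P n" by (simp add: vertex_sets_P_def)
  have "card R = k"
    unfolding R_def by (subst card_image[OF R]) simp
  then have cutS: "card (cut S) = k"
    using card_cut[OF S] childS
    by (simp add: SR Diff_eq_empty_iff[THEN iffD2])
  have "delta n = k"
    unfolding delta_def
  proof (rule antisym)
    show "(INF S\<in>vertex_sets n. card (cut S)) \<le> k"
      using cINF_lower[OF _ Sn, of "\<lambda>S. card (cut S)"] cutS by simp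
    show "k \<le> (INF S\<in>vertex_sets n. card (cut S))"
      using Sn lower by (intro cINF_greatest) auto
  qed
  moreover have "delta_P n = k"
    unfolding delta_P_def
  proof (rule antisym)
    show "(INF S\<in>vertex_sets_P n. card (cut S)) \<le> k"
      using cINF_lower[OF _ SP, of "\<lambda>S. card (cut S)"] cutS by simp
    show "k \<le> (INF S\<in>vertex_sets_P n. card (cut S))"
      using SP lower by (intro cINF_greatest) (auto simp: vertex_sets_P_def)
  qed
  ultimately show ?thesis by simp
qed

end
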